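(* Let $\mathsf{PROP}$ be a fixed finite set of propositional symbols, let $\mathcal{C}$ be a class of finite pointed Kripke models over $\mathsf{PROP}$ (closed under isomorphism), and let $L\in\mathbb{N}$. The following are equivalent: (1) $\mathcal{C}$ is preserved under homomorphisms and invariant under $L$-unravelling; (2) $\mathcal{C}$ is definable by an $\exists^+\mathcal{ML}$ formula of modal depth at most $L$.
   Context: All models are finite. A Kripke model is $\mathfrak{M}=(W,R,V)$ with $W$ a non-empty finite set of worlds, $R\subseteq W\times W$, $V$ mapping each $p\in\mathsf{PROP}$ to a subset of $W$. A pointed model is $(\mathfrak{M},w)$ with $w\in W$. For pointed models $(\mathfrak{M},w)$, $(\mathfrak{N},v)$ with $\mathfrak{N}=(W',R',V')$, a homomorphism is a map $f:W\to W'$ with $f(w)=v$ such that $uRz$ implies $f(u)R'f(z)$ and $u\in V(p)$ implies $f(u)\in V'(p)$ for all $u,z\in W$, $p\in\mathsf{PROP}$. $\mathcal{C}$ is preserved under homomorphisms if $(\mathfrak{M},w)\in\mathcal{C}$ and a homomorphism from $(\mathfrak{M},w)$ to $(\mathfrak{N},v)$ exists imply $(\mathfrak{N},v)\in\mathcal{C}$. The $L$-unravelling $\mathsf{Unr}^L(\mathfrak{M},w)$ is the pointed model whose worlds are tuples $(w,v_1,\dots,v_\ell)$ with $0\le\ell\le L$ and $wRv_1,\dots,v_{\ell-1}Rv_\ell$; distinguished world $(w)$; $(w,\dots,v_{\ell-1})$ related to $(w,\dots,v_\ell)$ (and no other pairs); $(w,v_1,\dots,v_\ell)$ satisfies $p$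 iff $v_\ell\in V(p)$ ($v_0=w$). $\mathcal{C}$ is invariant under $L$-unravelling if $(\mathfrak{M},w)\in\mathcal{C}$ iff $\mathsf{Unr}^L(\mathfrak{M},w)\in\mathcal{C}$. Basic modal logic $\mathcal{ML}$: $\varphi::=p\mid\neg\varphi\mid\varphi\wedge\varphi\mid\varphi\vee\varphi\mid\Diamond\varphi$, with $(\mathfrak{M},w)\models\Diamond\varphi$ iff some $u$ with $wRu$ satisfies $\varphi$. Modal depth is the maximal nesting of $\Diamond$. $\exists^+\mathcal{ML}$ is the negation-free fragment. $\mathcal{C}$ is definable by $\varphi$ if for all finite pointed models, $(\mathfrak{M},w)\models\varphi$ iff $(\mathfrak{M},w)\in\mathcal{C}$.
   Formalization: The constants ⊤ and ⊥ are added to the formulas of ∃⁺ML: with the displayed grammar alone the class of all pointed models and the empty class satisfy (1) but are not definable by a negation-free formula. *)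

theory Defs
  imports Main
begin

record ('w, 'p) kripke =
  worlds :: "'w set"
  acc :: "('w \<times> 'w) set"
  val :: "'p \<Rightarrow> 'w set"

type_synonym ('w, 'p) pointed = "('w, 'p) kripke \<times> 'w"

text \<open>The signature is a set rather than a type, so that it may be empty. A valuation is a function
  with domain \<open>Props\<close>, represented as a total function that is empty outside \<open>Props\<close>.\<close>

definition kripke_model :: "'p set \<Rightarrow> ('w, 'p) kripke \<Rightarrow> bool" where
  "kripke_model Props M \<longleftrightarrow>
     finite (worlds M) \<and> worlds M \<noteq> {} \<and> acc M \<subseteq> worlds M \<times> worlds M \<and>
     (\<forall>p\<in>Props. val M p \<subseteq> worlds M) \<and> (\<forall>p. p \<notin> Props \<longrightarrow> val M p = {})"

definition pointed_models :: "'p set \<Rightarrow> ('w, 'p) pointed set" where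
  "pointed_models Props = {(M, w). kripke_model Props M \<and> w \<in> worlds M}"

definition homomorphism ::
  "'p set \<Rightarrow> ('w \<Rightarrow> 'v) \<Rightarrow> ('w, 'p) pointed \<Rightarrow> ('v, 'p) pointed \<Rightarrow> bool" where
  "homomorphism Props f = (\<lambda>(M, w) (N, v).
     f ` worlds M \<subseteq> worlds N \<and> f w = v \<and>
     (\<forall>u\<in>worlds M. \<forall>z\<in>worlds M. (u, z) \<in> acc M \<longrightarrow> (f u, f z) \<in> acc N) \<and>
     (\<forall>u\<in>worlds M. \<forall>p\<in>Props. u \<in> val M p \<longrightarrow> f u \<in> val N p))"

definition isomorphism ::
  "'p set \<Rightarrow> ('w \<Rightarrow> 'v) \<Rightarrow> ('w, 'p) pointed \<Rightarrow> ('v, 'p) pointed \<Rightarrow> bool" where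
  "isomorphism Props f = (\<lambda>(M, w) (N, v).
     bij_betw f (worlds M) (worlds N) \<and> f w = v \<and>
     (\<forall>u\<in>worlds M. \<forall>z\<in>worlds M. (u, z) \<in> acc M \<longleftrightarrow> (f u, f z) \<in> acc N) \<and>
     (\<forall>u\<in>worlds M. \<forall>p\<in>Props. u \<in> val M p \<longleftrightarrow> f u \<in> val N p))"

text \<open>A universe of worlds closed under forming tuples, so that a model and its unravellings
  live in the same type and can be members of the same class. Up to isomorphism it
  contains every finite pointed model (see \<open>ex_isomorphic_world\<close> below).\<close>

datatype 'a world = Point 'a | Tuple "'a world list"

definition paths :: "nat \<Rightarrow> ('w, 'p) pointed \<Rightarrow> 'w list set" where
  "paths L = (\<lambda>(M, w). {w # vs | vs. length vs \<le> L \<and>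
     successively (\<lambda>u z. (u, z) \<in> acc M) (w # vs)})"

definition unravelling :: "nat \<Rightarrow> ('a world, 'p) pointed \<Rightarrow> ('a world, 'p) pointed" where
  "unravelling L = (\<lambda>(M, w).
     (\<lparr>worlds = Tuple ` paths L (M, w),
       acc = {(Tuple us, Tuple (us @ [v])) | us v.
                us \<in> paths L (M, w) \<and> us @ [v] \<in> paths L (M, w)},
       val = (\<lambda>p. {Tuple us | us. us \<in> paths L (M, w) \<and> last us \<in> val M p})\<rparr>,
      Tuple [w]))"

definition isomorphism_closed :: "'p set \<Rightarrow> ('w, 'p) pointed set \<Rightarrow> bool" where
  "isomorphism_closed Props C \<longleftrightarrow>
     (\<forall>A\<in>C. \<forall>B\<in>pointed_models Props. (\<exists>f. isomorphism Props f A B) \<longrightarrow> B \<in> C)"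

definition preserved_under_homomorphisms :: "'p set \<Rightarrow> ('w, 'p) pointed set \<Rightarrow> bool" where
  "preserved_under_homomorphisms Props C \<longleftrightarrow>
     (\<forall>A\<in>pointed_models Props. \<forall>B\<in>pointed_models Props.
        A \<in> C \<and> (\<exists>f. homomorphism Props f A B) \<longrightarrow> B \<in> C)"

definition invariant_under_unravelling ::
  "'p set \<Rightarrow> nat \<Rightarrow> ('a world, 'p) pointed set \<Rightarrow> bool" where
  "invariant_under_unravelling Props L C \<longleftrightarrow>
     (\<forall>A\<in>pointed_models Props. A \<in> C \<longleftrightarrow> unravelling L A \<in> C)"

text \<open>The constants \<open>Top\<close> and \<open>Bot\<close> (empty conjunction and disjunction) are primitive because in
  the negation-free fragment they cannot be defined from propositional symbols, and without them
  neither the class of all pointed models nor the empty class would be definable there.\<close>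

datatype 'p form =
    Prop 'p
  | Top
  | Bot
  | Neg "'p form"
  | And "'p form" "'p form"
  | Or "'p form" "'p form"
  | Dia "'p form"

fun sat :: "('w, 'p) kripke \<Rightarrow> 'w \<Rightarrow> 'p form \<Rightarrow> bool" where
  "sat M w (Prop p) \<longleftrightarrow> w \<in> val M p"
| "sat M w Top \<longleftrightarrow> True"
| "sat M w Bot \<longleftrightarrow> False"
| "sat M w (Neg \<phi>) \<longleftrightarrow> \<not> sat M w \<phi>"
| "sat M w (And \<phi> \<psi>) \<longleftrightarrow> sat M w \<phi> \<and> sat M w \<psi>"
| "sat M w (Or \<phi> \<psi>) \<longleftrightarrow> sat M w \<phi> \<or> sat M w \<psi>"
| "sat M w (Dia \<phi>) \<longleftrightarrow> (\<exists>u\<in>worlds M. (w, u) \<in> acc M \<and> sat M u \<phi>)"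

fun modal_depth :: "'p form \<Rightarrow> nat" where
  "modal_depth (Prop p) = 0"
| "modal_depth Top = 0"
| "modal_depth Bot = 0"
| "modal_depth (Neg \<phi>) = modal_depth \<phi>"
| "modal_depth (And \<phi> \<psi>) = max (modal_depth \<phi>) (modal_depth \<psi>)"
| "modal_depth (Or \<phi> \<psi>) = max (modal_depth \<phi>) (modal_depth \<psi>)"
| "modal_depth (Dia \<phi>) = Suc (modal_depth \<phi>)"

fun negation_free :: "'p form \<Rightarrow> bool" where
  "negation_free (Prop p) \<longleftrightarrow> True"
| "negation_free Top \<longleftrightarrow> True"
| "negation_free Bot \<longleftrightarrow> True"
| "negation_free (Neg \<phi>) \<longleftrightarrow> False"
| "negation_free (And \<phi> \<psi>) \<longleftrightarrow> negation_free \<phi> \<and> negation_free \<psi>"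
| "negation_free (Or \<phi> \<psi>) \<longleftrightarrow> negation_free \<phi> \<and> negation_free \<psi>"
| "negation_free (Dia \<phi>) \<longleftrightarrow> negation_free \<phi>"

definition modal_formulas :: "'p set \<Rightarrow> 'p form set" where
  "modal_formulas Props = {\<phi>. set_form \<phi> \<subseteq> Props}"

definition pos_ex_modal_formulas :: "'p set \<Rightarrow> 'p form set" where
  "pos_ex_modal_formulas Props = {\<phi> \<in> modal_formulas Props. negation_free \<phi>}"

definition definable_by :: "'p set \<Rightarrow> ('w, 'p) pointed set \<Rightarrow> 'p form \<Rightarrow> bool" where
  "definable_by Props C \<phi> \<longleftrightarrow>
     (\<forall>(M, w)\<in>pointed_models Props. sat M w \<phi> \<longleftrightarrow> (M, w) \<in> C)"

lemma finite_paths: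
  assumes "(M, w) \<in> pointed_models Props"
  shows "finite (paths L (M, w))"
proof -
  have *: "set vs \<subseteq> worlds M"
    if "successively (\<lambda>u z. (u, z) \<in> acc M) (v # vs)" for v vs
    using that assms
    by (induction vs arbitrary: v) (auto simp: pointed_models_def kripke_model_def)
  have "paths L (M, w) \<subseteq> (#) w ` {vs. set vs \<subseteq> worlds M \<and> length vs \<le> L}"
    using * by (auto simp: paths_def)
  moreover have "finite {vs. set vs \<subseteq> worlds M \<and> length vs \<le> L}"
    using assms by (intro finite_lists_length_le) (auto simp: pointed_models_def kripke_model_def)
  ultimately show ?thesis
    by (meson finite_imageI finite_subset)
qed

lemma unravelling_in_pointed_models:
  assumes "A \<in> pointed_models Props"
  shows "unravelling L A \<in> pointed_models Props"
proof -
  obtain M w where A: "A = (M, w)" by fastforce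
  have "[w] \<in> paths L (M, w)" by (auto simp: paths_def)
  then show ?thesis
    using assms finite_paths[of M w Props L]
    by (auto simp: A unravelling_def pointed_models_def kripke_model_def)
qed

lemma ex_isomorphic_world:
  fixes A :: "('w, 'p) pointed"
  assumes "A \<in> pointed_models Props"
  shows "\<exists>(B :: ('a world, 'p) pointed) f. B \<in> pointed_models Props \<and> isomorphism Props f A B"
proof -
  obtain M w where A: "A = (M, w)" by fastforce
  from assms have M: "kripke_model Props M" and w: "w \<in> worlds M"
    by (auto simp: A pointed_models_def)
  from M have "finite (worlds M)" by (simp add: kripke_model_def)
  then obtain g :: "'w \<Rightarrow> nat" where g: "inj_on g (worlds M)"
    using finite_imp_inj_to_nat_seg by blast
  define f :: "'w \<Rightarrow> 'a world" where "f u = Tuple (replicate (g u) (Tuple []))" for u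
  have f: "inj_on f (worlds M)"
    using g by (auto simp: inj_on_def f_def replicate_eq_replicate)
  define N where "N = \<lparr>worlds = f ` worlds M, acc = map_prod f f ` acc M, val = (\<lambda>p. f ` val M p)\<rparr>"
  have accW: "u \<in> worlds M \<and> z \<in> worlds M" if "(u, z) \<in> acc M" for u z
    using that M by (auto simp: kripke_model_def)
  have valW: "u \<in> worlds M" if "u \<in> val M p" for u p
    using that M by (cases "p \<in> Props") (auto simp: kripke_model_def)
  have N: "(N, f w) \<in> pointed_models Props"
    unfolding pointed_models_def kripke_model_def N_def
    using M w accW valW by (auto simp: kripke_model_def)
  have acc_iff: "(u, z) \<in> acc M \<longleftrightarrow> (f u, f z) \<in> acc N" if uz: "u \<in> worlds M" "z \<in> worlds M" for u z
  proof
    assume "(f u, f z) \<in> acc N"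
    then obtain u' z' where *: "(u', z') \<in> acc M" "f u = f u'" "f z = f z'"
      by (auto simp: N_def)
    then have "u = u'" "z = z'"
      using inj_onD[OF f] uz accW by blast+
    with * show "(u, z) \<in> acc M" by simp
  qed (force simp: N_def)
  have val_iff: "u \<in> val M p \<longleftrightarrow> f u \<in> val N p" if "u \<in> worlds M" for u p
    using inj_on_image_mem_iff[OF f that] valW by (simp add: N_def subset_iff)
  have "isomorphism Props f (M, w) (N, f w)"
    using f acc_iff val_iff by (auto simp: isomorphism_def bij_betw_def N_def)
  with N A show ?thesis by blast
qed

end

theory Submission
  imports Defs
begin

text \<open>A pointed model \<open>(M, w)\<close> has a positive existential characteristic formula of modal depth \<open>L\<close>,
  recording the symbols true at \<open>w\<close> and, below diamonds, the formulas of depth \<open>L - 1\<close> of the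
  successors of \<open>w\<close>. A pointed model satisfies it only if the \<open>L\<close>-unravelling of \<open>(M, w)\<close> maps
  into it homomorphically. Over a finite signature there are only finitely many such formulas, so a
  class that is preserved under homomorphisms and invariant under \<open>L\<close>-unravelling is defined by the
  disjunction of the characteristic formulas of its members.\<close>

section \<open>Finite conjunctions and disjunctions\<close>

text \<open>Both depend on the set alone, not on an enumeration of it; this is what makes the
  characteristic formulas finite in number.\<close>

definition Conj :: "'p form set \<Rightarrow> 'p form" where
  "Conj S = foldr And (SOME xs. set xs = S) Top"

definition Disj :: "'p form set \<Rightarrow> 'p form" where
  "Disj S = foldr Or (SOME xs. set xs = S) Bot"

lemma set_some_list:
  assumes "finite S"
  shows "set (SOME xs. set xs = S) = S"
  using finite_list[OF assms] by (rule someI_ex)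

lemma sat_Conj:
  assumes "finite S"
  shows "sat M w (Conj S) \<longleftrightarrow> (\<forall>\<phi>\<in>S. sat M w \<phi>)"
proof -
  have "sat M w (foldr And xs Top) \<longleftrightarrow> (\<forall>\<phi>\<in>set xs. sat M w \<phi>)" for xs
    by (induction xs) auto
  then show ?thesis
    by (simp add: Conj_def set_some_list[OF assms])
qed

lemma sat_Disj:
  assumes "finite S"
  shows "sat M w (Disj S) \<longleftrightarrow> (\<exists>\<phi>\<in>S. sat M w \<phi>)"
proof -
  have "sat M w (foldr Or xs Bot) \<longleftrightarrow> (\<exists>\<phi>\<in>set xs. sat M w \<phi>)" for xs
    by (induction xs) auto
  then show ?thesis
    by (simp add: Disj_def set_some_list[OF assms])
qed

definition pos_ex_depth :: "'p set \<Rightarrow> nat \<Rightarrow> 'p form set" where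
  "pos_ex_depth Props n = {\<phi> \<in> pos_ex_modal_formulas Props. modal_depth \<phi> \<le> n}"

lemma pos_ex_depth_simps [simp]:
  "Prop p \<in> pos_ex_depth Props n \<longleftrightarrow> p \<in> Props"
  "Top \<in> pos_ex_depth Props n"
  "Bot \<in> pos_ex_depth Props n"
  "And \<phi> \<psi> \<in> pos_ex_depth Props n \<longleftrightarrow> \<phi> \<in> pos_ex_depth Props n \<and> \<psi> \<in> pos_ex_depth Props n"
  "Or \<phi> \<psi> \<in> pos_ex_depth Props n \<longleftrightarrow> \<phi> \<in> pos_ex_depth Props n \<and> \<psi> \<in> pos_ex_depth Props n"
  "Dia \<phi> \<in> pos_ex_depth Props (Suc n) \<longleftrightarrow> \<phi> \<in> pos_ex_depth Props n"
  by (auto simp: pos_ex_depth_def pos_ex_modal_formulas_def modal_formulas_def)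

lemma Conj_in_pos_ex_depth:
  assumes "finite S" and "S \<subseteq> pos_ex_depth Props n"
  shows "Conj S \<in> pos_ex_depth Props n"
proof -
  have "set xs \<subseteq> pos_ex_depth Props n \<Longrightarrow> foldr And xs Top \<in> pos_ex_depth Props n" for xs
    by (induction xs) auto
  then show ?thesis
    using assms(2) by (simp add: Conj_def set_some_list[OF assms(1)])
qed

lemma Disj_in_pos_ex_depth:
  assumes "finite S" and "S \<subseteq> pos_ex_depth Props n"
  shows "Disj S \<in> pos_ex_depth Props n"
proof -
  have "set xs \<subseteq> pos_ex_depth Props n \<Longrightarrow> foldr Or xs Bot \<in> pos_ex_depth Props n" for xs
    by (induction xs) auto
  then show ?thesis
    using assms(2) by (simp add: Disj_def set_some_list[OF assms(1)])
qed

section \<open>Characteristic formulas\<close>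

definition successors :: "('w, 'p) kripke \<Rightarrow> 'w \<Rightarrow> 'w set" where
  "successors M w = {u \<in> worlds M. (w, u) \<in> acc M}"

definition true_props :: "'p set \<Rightarrow> ('w, 'p) kripke \<Rightarrow> 'w \<Rightarrow> 'p set" where
  "true_props Props M w = {p \<in> Props. w \<in> val M p}"

text \<open>The positive half of the Hintikka formula of depth \<open>n\<close>: with no negated
  symbols and no boxes, it says that \<open>n\<close> steps from \<open>w\<close> can be simulated.
  Forming an image merges successors with equal formulas.\<close>

primrec char_form :: "'p set \<Rightarrow> nat \<Rightarrow> ('w, 'p) kripke \<Rightarrow> 'w \<Rightarrow> 'p form" where
  "char_form Props 0 M w = Conj (Prop ` true_props Props M w)"
| "char_form Props (Suc n) M w =
     And (Conj (Prop ` true_props Props M w)) (Conj (Dia ` char_form Props n M ` successors M w))"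

lemma finite_true_props: "finite Props \<Longrightarrow> finite (true_props Props M w)"
  by (simp add: true_props_def)

lemma finite_successors: "kripke_model Props M \<Longrightarrow> finite (successors M w)"
  by (simp add: successors_def kripke_model_def)

text \<open>At depth \<open>Suc n\<close> a formula is fixed by a subset of \<open>Props\<close> and
  a set of formulas of depth \<open>n\<close>, so finiteness passes through power sets.\<close>

lemma finite_char_forms:
  assumes "finite Props"
  shows "finite (range (\<lambda>(M :: ('w, 'p) kripke, w). char_form Props n M w))"
proof (induction n)
  case 0
  have "range (\<lambda>(M :: ('w, 'p) kripke, w). char_form Props 0 M w)
      \<subseteq> (\<lambda>P. Conj (Prop ` P)) ` Pow Props"
    by (auto simp: true_props_def)
  then show ?case
    using assms by (meson finite_Pow_iff finite_imageI finite_subset)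
next
  case (Suc n)
  let ?F = "range (\<lambda>(M :: ('w, 'p) kripke, w). char_form Props n M w)"
  have "char_form Props (Suc n) M w
      \<in> (\<lambda>(P, S). And (Conj (Prop ` P)) (Conj (Dia ` S))) ` (Pow Props \<times> Pow ?F)"
    for M :: "('w, 'p) kripke" and w
    by (rule image_eqI[of _ _ "(true_props Props M w, char_form Props n M ` successors M w)"])
      (auto simp: true_props_def)
  then have "range (\<lambda>(M :: ('w, 'p) kripke, w). char_form Props (Suc n) M w)
      \<subseteq> (\<lambda>(P, S). And (Conj (Prop ` P)) (Conj (Dia ` S))) ` (Pow Props \<times> Pow ?F)"
    by (simp only: image_subset_iff split_paired_all prod.case) simp
  moreover have "finite (Pow Props \<times> Pow ?F)"
    using assms Suc.IH by simp
  ultimately show ?case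
    by (meson finite_imageI finite_subset)
qed

lemma char_form_in_pos_ex_depth:
  assumes "finite Props" and "kripke_model Props M"
  shows "char_form Props n M w \<in> pos_ex_depth Props n"
proof -
  have props: "Conj (Prop ` true_props Props M w) \<in> pos_ex_depth Props n" for n w
    by (intro Conj_in_pos_ex_depth finite_imageI finite_true_props assms)
      (auto simp: true_props_def)
  show ?thesis
  proof (induction n arbitrary: w)
    case 0
    show ?case by (simp add: props)
  next
    case (Suc n)
    have "Conj (Dia ` char_form Props n M ` successors M w) \<in> pos_ex_depth Props (Suc n)"
      by (intro Conj_in_pos_ex_depth finite_imageI finite_successors[OF assms(2)])
        (auto simp: Suc.IH)
    then show ?case by (simp add: props)
  qed
qed

lemma sat_char_form_0:
  assumes "finite Props"
  shows "sat N v (char_form Props 0 M w) \<longleftrightarrow> (\<forall>p\<in>Props. w \<in> val M p \<longrightarrow> v \<in> val N p)"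
  using finite_true_props[OF assms, of M w]
  by (auto simp: sat_Conj) (auto simp: true_props_def)

lemma sat_char_form_Suc:
  assumes "kripke_model Props M"
  shows "sat N v (char_form Props (Suc n) M w) \<longleftrightarrow> sat N v (char_form Props 0 M w) \<and>
    (\<forall>x\<in>successors M w. \<exists>u\<in>successors N v. sat N u (char_form Props n M x))"
  using finite_successors[OF assms, of w]
  by (auto simp: sat_Conj) (auto simp: successors_def)

text \<open>Every model simulates itself: each successor of \<open>w\<close> witnesses its own
  diamond.\<close>

lemma sat_char_form_self:
  assumes "finite Props" and "kripke_model Props M"
  shows "sat M w (char_form Props n M w)"
proof (induction n arbitrary: w)
  case 0
  show ?case by (simp only: sat_char_form_0[OF assms(1)]) simp
next
  case (Suc n)
  then show ?case
    by (auto simp only: sat_char_form_0[OF assms(1)] sat_char_form_Suc[OF assms(2)])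
qed

lemma sat_char_form_val:
  assumes "finite Props" and "kripke_model Props M" and "sat N v (char_form Props n M w)"
    and "p \<in> Props" and "w \<in> val M p"
  shows "v \<in> val N p"
proof -
  have "sat N v (char_form Props 0 M w)"
    using assms(3) sat_char_form_Suc[OF assms(2)] by (cases n) auto
  then show ?thesis
    using assms(4,5) unfolding sat_char_form_0[OF assms(1)] by blast
qed

text \<open>Supplies the existence claim behind the choice made by \<open>trace\<close>.\<close>

lemma sat_char_form_step:
  assumes "kripke_model Props M" and "sat N v (char_form Props (Suc n) M w)" and "(w, x) \<in> acc M"
  shows "\<exists>u. u \<in> successors N v \<and> sat N u (char_form Props n M x)"
proof -
  have "x \<in> successors M w"
    using assms(1,3) by (auto simp: successors_def kripke_model_def)
  then show ?thesis
    using assms(2) unfolding sat_char_form_Suc[OF assms(1)] by blast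
qed

section \<open>Homomorphisms from unravellings\<close>

text \<open>The path \<open>w # vs\<close> is traced in \<open>N\<close> from \<open>v\<close>; the first argument is the remaining depth.\<close>

fun trace ::
  "nat \<Rightarrow> 'p set \<Rightarrow> ('w, 'p) kripke \<Rightarrow> ('v, 'p) kripke \<Rightarrow> 'v \<Rightarrow> 'w list \<Rightarrow> 'v" where
  "trace n Props M N v [] = v"
| "trace n Props M N v (x # xs) = trace (n - 1) Props M N
     (SOME u. u \<in> successors N v \<and> sat N u (char_form Props (n - 1) M x)) xs"

text \<open>Invariant of the tracing: each step spends one level of the formula, and the bound on
  \<open>length xs\<close> ensures that a diamond is left for it.\<close>

lemma trace_sat:
  assumes "kripke_model Props M"
    and "sat N v (char_form Props n M w)" and "v \<in> worlds N"
    and "length xs \<le> n" and "successively (\<lambda>u z. (u, z) \<in> acc M) (w # xs)"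
  shows "trace n Props M N v xs \<in> worlds N \<and>
    sat N (trace n Props M N v xs) (char_form Props (n - length xs) M (last (w # xs)))"
  using assms(2-)
proof (induction xs arbitrary: n v w)
  case Nil
  then show ?case by simp
next
  case (Cons x xs)
  \<comment> \<open>A nonempty path within the bound forces \<open>n > 0\<close>, so
    \<open>n - 1\<close> in \<open>trace\<close> is a true predecessor.\<close>
  then obtain m where n: "n = Suc m" by (cases n) auto
  define u where "u = (SOME u. u \<in> successors N v \<and> sat N u (char_form Props m M x))"
  have u: "u \<in> successors N v \<and> sat N u (char_form Props m M x)"
    unfolding u_def using Cons.prems n
    by (intro someI_ex[OF sat_char_form_step[OF assms(1), of _ _ _ w]]) auto
  then have "u \<in> worlds N"
    by (simp add: successors_def)
  then show ?case
    using Cons.IH[of u m x] Cons.prems u by (simp add: n u_def[symmetric])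
qed

text \<open>The choices along \<open>xs\<close> do not depend on what follows, so extending a path
  keeps the image of its prefix.\<close>

lemma trace_append:
  "trace n Props M N v (xs @ ys) =
     trace (n - length xs) Props M N (trace n Props M N v xs) ys"
  by (induction xs arbitrary: n v) auto

lemma trace_acc:
  assumes "kripke_model Props M"
    and "sat N v (char_form Props n M w)" and "v \<in> worlds N"
    and "length (xs @ [x]) \<le> n" and "successively (\<lambda>u z. (u, z) \<in> acc M) (w # xs @ [x])"
  shows "(trace n Props M N v xs, trace n Props M N v (xs @ [x])) \<in> acc N"
proof -
  obtain m where m: "n - length xs = Suc m"
    using assms(4) by (cases "n - length xs") auto
  have succ: "successively (\<lambda>u z. (u, z) \<in> acc M) (w # xs)" "(last (w # xs), x) \<in> acc M"
    using assms(5) successively_append_iff[of _ "w # xs" "[x]"] by simp_all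
  \<comment> \<open>The prefix is shorter than \<open>n\<close>, so a level remains; its diamond for
    \<open>x\<close> provides the world that \<open>trace\<close> chooses.\<close>
  have "sat N (trace n Props M N v xs) (char_form Props (Suc m) M (last (w # xs)))"
    using trace_sat[OF assms(1-3) _ succ(1)] assms(4) m by simp
  from someI_ex[OF sat_char_form_step[OF assms(1) this succ(2)]]
  show ?thesis by (simp add: trace_append m successors_def)
qed

text \<open>A world of \<open>M\<close> reached along several paths may need several images in
  \<open>N\<close>. In the unravelling each path is a world of its own, so the choices of
  \<open>trace\<close> never conflict.\<close>

lemma homomorphism_from_unravelling:
  fixes M :: "('a world, 'p) kripke"
  assumes "finite Props" and "kripke_model Props M"
    and "sat N v (char_form Props L M w)" and "v \<in> worlds N"
  shows "\<exists>f. homomorphism Props f (unravelling L (M, w)) (N, v)"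
proof -
  \<comment> \<open>\<open>tl\<close> drops the root, which is sent to \<open>v\<close> with all
    \<open>L\<close> levels left. The value on \<open>Point\<close> is a mere default: the worlds of
    an unravelling are tuples.\<close>
  define f where "f t = (case t of Tuple us \<Rightarrow> trace L Props M N v (tl us) | _ \<Rightarrow> v)"
    for t :: "'a world"
  have f: "f (Tuple (w # vs)) = trace L Props M N v vs" for vs
    by (simp add: f_def)
  note sat = trace_sat[OF assms(2-4)]
  have "f t \<in> worlds N" if "t \<in> Tuple ` paths L (M, w)" for t
    using that sat by (auto simp: paths_def f)
  moreover have "(f (Tuple us), f (Tuple (us @ [x]))) \<in> acc N"
    if "us \<in> paths L (M, w)" and "us @ [x] \<in> paths L (M, w)" for us x
    using that trace_acc[OF assms(2-4), of "tl us" x] by (auto simp: paths_def f)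
  moreover have "f (Tuple us) \<in> val N p"
    if "us \<in> paths L (M, w)" and "last us \<in> val M p" and "p \<in> Props" for us p
  proof -
    from that(1) obtain vs where vs: "us = w # vs" "length vs \<le> L"
        "successively (\<lambda>u z. (u, z) \<in> acc M) (w # vs)"
      by (auto simp: paths_def)
    show ?thesis
      using sat_char_form_val[OF assms(1,2) conjunct2[OF sat[OF vs(2,3)]] that(3)] that(2)
      unfolding vs(1) f by blast
  qed
  ultimately have "homomorphism Props f (unravelling L (M, w)) (N, v)"
    by (auto simp: homomorphism_def unravelling_def f)
  then show ?thesis by blast
qed

section \<open>Preservation of satisfaction\<close>

text \<open>Symbols and successors move forwards along \<open>f\<close>, and all connectives but
  negation are monotone. The world \<open>u\<close> is arbitrary because diamonds leave the
  distinguished one.\<close>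

lemma sat_homomorphism:
  assumes "homomorphism Props f (M, w) (N, v)"
    and "negation_free \<phi>" and "set_form \<phi> \<subseteq> Props" and "u \<in> worlds M" and "sat M u \<phi>"
  shows "sat N (f u) \<phi>"
  using assms(2-)
proof (induction \<phi> arbitrary: u)
  case (Dia \<phi>)
  then obtain z where "z \<in> worlds M" "(u, z) \<in> acc M" "sat M z \<phi>" by auto
  with Dia assms(1) show ?case
    by (auto simp: homomorphism_def intro!: bexI[of _ "f z"])
qed (use assms(1) in \<open>auto simp: homomorphism_def\<close>)

lemma paths_snoc:
  assumes "us \<in> paths L (M, w)"
  shows "us @ [x] \<in> paths L (M, w) \<longleftrightarrow> length us \<le> L \<and> (last us, x) \<in> acc M"
  using assms successively_append_iff[of "\<lambda>u z. (u, z) \<in> acc M" us "[x]"]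
  by (auto simp: paths_def)

text \<open>A path includes the root, so \<open>us\<close> has made \<open>length us - 1\<close>
  steps; the bound says that the remaining steps cover the depth of \<phi>.\<close>

lemma sat_unravelling:
  assumes "kripke_model Props M"
    and "us \<in> paths L (M, w)" and "length us + modal_depth \<phi> \<le> Suc L"
  shows "sat (fst (unravelling L (M, w))) (Tuple us) \<phi> \<longleftrightarrow> sat M (last us) \<phi>"
  using assms(2-)
proof (induction \<phi> arbitrary: us)
  case (Dia \<phi>)
  have IH: "sat (fst (unravelling L (M, w))) (Tuple (us @ [x])) \<phi> \<longleftrightarrow> sat M x \<phi>"
    if "us @ [x] \<in> paths L (M, w)" for x
    using Dia.IH[OF that] Dia.prems(2) by simp
  have "sat (fst (unravelling L (M, w))) (Tuple us) (Dia \<phi>) \<longleftrightarrow>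
      (\<exists>x. us @ [x] \<in> paths L (M, w) \<and>
        sat (fst (unravelling L (M, w))) (Tuple (us @ [x])) \<phi>)"
    using Dia.prems(1) by (auto simp: unravelling_def)
  \<comment> \<open>A diamond has depth at least 1, so the bound gives
    \<open>length us \<le> L\<close> and every successor of \<open>last us\<close> extends the
    path.\<close>
  also have "\<dots> \<longleftrightarrow> (\<exists>x. (last us, x) \<in> acc M \<and> sat M x \<phi>)"
    using IH paths_snoc[OF Dia.prems(1)] Dia.prems(2) by auto
  also have "\<dots> \<longleftrightarrow> sat M (last us) (Dia \<phi>)"
    using assms(1) by (auto simp: kripke_model_def)
  finally show ?case .
qed (auto simp: unravelling_def)

section \<open>The characterisation\<close>

lemma definable_if_preserved_and_invariant:
  fixes C :: "('a world, 'p) pointed set"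
  assumes "finite Props" and "C \<subseteq> pointed_models Props"
    and "preserved_under_homomorphisms Props C" and "invariant_under_unravelling Props L C"
  shows "\<exists>\<phi>\<in>pos_ex_modal_formulas Props. modal_depth \<phi> \<le> L \<and> definable_by Props C \<phi>"
proof -
  \<comment> \<open>\<open>C\<close> may be infinite, but \<open>F\<close> lies in the finite range
    of \<open>char_form\<close> at depth \<open>L\<close>. An empty \<open>C\<close> yields the
    disjunction \<open>Bot\<close>.\<close>
  define F where "F = (\<lambda>(M, w). char_form Props L M w) ` C"
  have fin: "finite F"
    unfolding F_def by (rule finite_subset[OF _ finite_char_forms[OF assms(1), of L]]) blast
  have model: "kripke_model Props M" if "(M, w) \<in> C" for M w
    using that assms(2) by (auto simp: pointed_models_def)
  have "F \<subseteq> pos_ex_depth Props L"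
    using char_form_in_pos_ex_depth[OF assms(1) model] by (auto simp: F_def)
  from Disj_in_pos_ex_depth[OF fin this]
  have "Disj F \<in> pos_ex_modal_formulas Props" "modal_depth (Disj F) \<le> L"
    by (auto simp: pos_ex_depth_def)
  moreover have "sat N v (Disj F) \<longleftrightarrow> (N, v) \<in> C" if N: "(N, v) \<in> pointed_models Props" for N v
  proof
    assume "sat N v (Disj F)"
    then obtain M w where M: "(M, w) \<in> C" and sat: "sat N v (char_form Props L M w)"
      by (auto simp: F_def sat_Disj[OF fin[unfolded F_def]])
    have "v \<in> worlds N"
      using N by (simp add: pointed_models_def)
    from homomorphism_from_unravelling[OF assms(1) model[OF M] sat this]
    obtain f where "homomorphism Props f (unravelling L (M, w)) (N, v)" ..
    moreover have "unravelling L (M, w) \<in> C"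
      using assms(2,4) M unfolding invariant_under_unravelling_def by blast
    ultimately show "(N, v) \<in> C"
      using assms(2,3) N unfolding preserved_under_homomorphisms_def by blast
  next
    assume NC: "(N, v) \<in> C"
    then have "char_form Props L N v \<in> F"
      by (force simp: F_def)
    with sat_char_form_self[OF assms(1) model[OF NC]] show "sat N v (Disj F)"
      by (auto simp: sat_Disj[OF fin])
  qed
  ultimately show ?thesis
    unfolding definable_by_def by blast
qed

lemma preserved_if_definable:
  fixes C :: "('w, 'p) pointed set"
  assumes "\<phi> \<in> pos_ex_modal_formulas Props" and "definable_by Props C \<phi>"
  shows "preserved_under_homomorphisms Props C"
  unfolding preserved_under_homomorphisms_def
proof (intro ballI impI, elim conjE exE)
  fix A B :: "('w, 'p) pointed" and f
  assume "A \<in> pointed_models Props" "B \<in> pointed_models Props" "A \<in> C" "homomorphism Props f A B"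
  moreover obtain M w N v where "A = (M, w)" "B = (N, v)"
    by (cases A, cases B)
  moreover have "f w = v" if "homomorphism Props f (M, w) (N, v)"
    using that by (simp add: homomorphism_def)
  ultimately show "B \<in> C"
    using assms sat_homomorphism[of Props f M w N v \<phi> w]
    by (auto simp: definable_by_def pointed_models_def pos_ex_modal_formulas_def modal_formulas_def)
qed

lemma invariant_if_definable:
  fixes C :: "('a world, 'p) pointed set"
  assumes "modal_depth \<phi> \<le> L" and "definable_by Props C \<phi>"
  shows "invariant_under_unravelling Props L C"
  unfolding invariant_under_unravelling_def
proof
  fix A :: "('a world, 'p) pointed"
  assume A: "A \<in> pointed_models Props"
  obtain M w where Mw: "A = (M, w)" by (cases A)
  have unr: "unravelling L A = (fst (unravelling L (M, w)), Tuple [w])"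
    by (simp add: Mw unravelling_def)
  have "A \<in> C \<longleftrightarrow> sat M w \<phi>"
    using A assms(2) by (auto simp: definable_by_def Mw)
  \<comment> \<open>The root path has length 1, so the bound of \<open>sat_unravelling\<close>
    becomes \<open>modal_depth \<phi> \<le> L\<close>.\<close>
  also have "\<dots> \<longleftrightarrow> sat (fst (unravelling L (M, w))) (Tuple [w]) \<phi>"
    using sat_unravelling[of Props M "[w]" L w \<phi>] A assms(1)
    by (simp add: Mw pointed_models_def paths_def)
  also have "\<dots> \<longleftrightarrow> unravelling L A \<in> C"
    using unravelling_in_pointed_models[OF A, of L] assms(2)
    unfolding unr definable_by_def by blast
  finally show "A \<in> C \<longleftrightarrow> unravelling L A \<in> C" .
qed

theorem theorem4p15:
  fixes Props :: "'p set" and C :: "('a world, 'p) pointed set" and L :: nat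
  assumes "finite Props"
    and "C \<subseteq> pointed_models Props"
    and "isomorphism_closed Props C"
  shows "(preserved_under_homomorphisms Props C \<and> invariant_under_unravelling Props L C)
    \<longleftrightarrow> (\<exists>\<phi>\<in>pos_ex_modal_formulas Props. modal_depth \<phi> \<le> L \<and> definable_by Props C \<phi>)"
  using definable_if_preserved_and_invariant[OF assms(1,2)] preserved_if_definable
    invariant_if_definable
  by blast

end
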